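(* Let $r\geq 1$ and $m\geq 1$ be integers. For each integer $p\ge 1$, let $G_p^{(r)}(x)$ be the polynomial (which exists and is unique) such that $S_p^{(r)}(n)=S_1^{(r)}(n)\,G_p^{(r)}\!\left(n+\frac r2\right)$ for all integers $n\geq 1$, and write $N_r=n+\frac r2$. Then $$G_{2m-1}^{(r)}(N_r)=\sum_{j=0}^{m-1} g_{2m-1,j}^{(r)}\,N_r^{2j},\qquad G_{2m}^{(r)}(N_r)=\sum_{j=0}^{m-1} g_{2m,j}^{(r)}\,N_r^{2j+1},$$ for certain non-zero rational coefficients $g_{2m-1,j}^{(r)}$ and $g_{2m,j}^{(r)}$, $j=0,1,\dots,m-1$. Moreover, the coefficients $g_{2m-1,m-1}^{(r)}, g_{2m-1,m-2}^{(r)},\dots,g_{2m-1,0}^{(r)}$ alternate in sign with the leading coefficient $g_{2m-1,m-1}^{(r)}$ positive, and likewise the coefficients $g_{2m,m-1}^{(r)}, g_{2m,m-2}^{(r)},\dots,g_{2m,0}^{(r)}$ alternate in sign with $g_{2m,m-1}^{(r)}$ positive.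
   Context: For integers $m,r\geq 0$ and $n\geq 1$, the hyper-sums of powers of integers are defined recursively by $S_m^{(0)}(n)=n^m$ and $S_m^{(r)}(n)=\sum_{i=1}^n S_m^{(r-1)}(i)$ for $r\geq 1$. In particular $S_1^{(r)}(n)=\binom{n+r}{r+1}$, which is nonzero for all $n\ge 1$. *)

theory Defs
  imports Complex_Main "HOL-Computational_Algebra.Polynomial"
begin

primrec hyper_sum :: "nat \<Rightarrow> nat \<Rightarrow> nat \<Rightarrow> nat" where
  "hyper_sum m 0 n = n ^ m"
| "hyper_sum m (Suc r) n = (\<Sum>i = 1..n. hyper_sum m r i)"

definition N_shift :: "nat \<Rightarrow> nat \<Rightarrow> real" where
  "N_shift r n = real n + real r / 2"

definition is_G_poly :: "nat \<Rightarrow> nat \<Rightarrow> real poly \<Rightarrow> bool" where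
  "is_G_poly r p G \<longleftrightarrow>
     (\<forall>n\<ge>1. real (hyper_sum p r n) = real (hyper_sum 1 r n) * poly G (N_shift r n))"

text \<open>The value is meaningful only when exactly one polynomial satisfies
  \<^const>\<open>is_G_poly\<close>; this holds for all positive \<open>r\<close> and \<open>p\<close>.\<close>

definition G_poly :: "nat \<Rightarrow> nat \<Rightarrow> real poly" where
  "G_poly r p = (THE G. is_G_poly r p G)"

end

theory Submission
  imports Defs "HOL-Computational_Algebra.Formal_Power_Series"
    "HOL-Analysis.Equivalence_Lebesgue_Henstock_Integration"
begin

text \<open>The polynomials have the exponential generating function
  \<open>\<Sum>p\<ge>1. G\<^sub>p(x) t^p / p! = (r + 1) t \<integral> exp(u x t) W(u)^r du\<close> over \<open>0 \<le> u \<le> 1\<close>, where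
  \<open>W(u) = sinh((1 - u) t / 2) / sinh(t / 2)\<close>.  Integration by parts turns this formula for \<open>r + 1\<close>
  into a difference equation with the formula for \<open>r\<close> on the right-hand side, which is the
  recursion of the hyper-sums divided by a binomial coefficient.  As a power series in \<open>t\<close>,
  \<open>W(u)\<close> is even and its even coefficients alternate strictly in sign for \<open>0 < u < 1\<close>.
  Products inherit this property, and integrating it yields the signs of the coefficients of
  \<open>G\<^sub>p\<close>.  They are rational because \<open>G\<^sub>p\<close> takes rational values at infinitely many
  rational points.\<close>

unbundle fps_syntax

section \<open>Power series depending on a real parameter\<close>

text \<open>The derivative is taken in the parameter u, not in the formal variable t. Working
  coefficient by coefficient avoids all questions of convergence in t.\<close>

definition has_coeff_deriv :: "(real \<Rightarrow> real fps) \<Rightarrow> (real \<Rightarrow> real fps) \<Rightarrow> bool" where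
  "has_coeff_deriv F F' \<longleftrightarrow> (\<forall>u k. ((\<lambda>u. F u $ k) has_real_derivative F' u $ k) (at u))"

definition coeff_integral :: "(real \<Rightarrow> real fps) \<Rightarrow> real fps" where
  "coeff_integral F = Abs_fps (\<lambda>k. integral {0..1} (\<lambda>u. F u $ k))"

definition coeff_continuous :: "(real \<Rightarrow> real fps) \<Rightarrow> bool" where
  "coeff_continuous F \<longleftrightarrow> (\<forall>k. continuous_on UNIV (\<lambda>u. F u $ k))"

lemma has_coeff_deriv_const: "has_coeff_deriv (\<lambda>_. c) (\<lambda>_. 0)"
  by (simp add: has_coeff_deriv_def)

lemma has_coeff_deriv_add:
  assumes "has_coeff_deriv F F'" "has_coeff_deriv G G'"
  shows "has_coeff_deriv (\<lambda>u. F u + G u) (\<lambda>u. F' u + G' u)"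
  using assms by (auto simp: has_coeff_deriv_def intro!: derivative_eq_intros)

lemma has_coeff_deriv_diff:
  assumes "has_coeff_deriv F F'" "has_coeff_deriv G G'"
  shows "has_coeff_deriv (\<lambda>u. F u - G u) (\<lambda>u. F' u - G' u)"
  using assms by (auto simp: has_coeff_deriv_def intro!: derivative_eq_intros)

lemma has_coeff_deriv_mult:
  assumes "has_coeff_deriv F F'" "has_coeff_deriv G G'"
  shows "has_coeff_deriv (\<lambda>u. F u * G u) (\<lambda>u. F' u * G u + F u * G' u)"
  unfolding has_coeff_deriv_def
proof (intro allI)
  fix u :: real and k :: nat
  have F: "((\<lambda>u. F u $ i) has_real_derivative F' u $ i) (at u)"
    and G: "((\<lambda>u. G u $ i) has_real_derivative G' u $ i) (at u)" for i
    using assms by (simp_all add: has_coeff_deriv_def)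
  show "((\<lambda>u. (F u * G u) $ k) has_real_derivative (F' u * G u + F u * G' u) $ k) (at u)"
    unfolding fps_mult_nth
    by (rule derivative_eq_intros F G refl)+
       (simp add: fps_mult_nth sum.distrib mult.commute add.commute)
qed

lemma has_coeff_deriv_power:
  assumes "has_coeff_deriv F F'"
  shows "has_coeff_deriv (\<lambda>u. F u ^ Suc n) (\<lambda>u. of_nat (Suc n) * F u ^ n * F' u)"
proof (induction n)
  case 0
  show ?case using assms by simp
next
  case (Suc n)
  have "F' u * F u ^ Suc n + F u * (of_nat (Suc n) * F u ^ n * F' u)
      = of_nat (Suc (Suc n)) * F u ^ Suc n * F' u" for u
    by (simp add: algebra_simps)
  then show ?case
    using has_coeff_deriv_mult[OF assms Suc] by simp
qed

lemma has_coeff_deriv_shift: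
  "has_coeff_deriv F F' \<Longrightarrow> has_coeff_deriv (\<lambda>u. fps_shift n (F u)) (\<lambda>u. fps_shift n (F' u))"
  by (simp add: has_coeff_deriv_def)

lemma has_coeff_deriv_exp:
  assumes "\<And>u. (f has_real_derivative a) (at u)"
  shows "has_coeff_deriv (\<lambda>u. fps_exp (f u)) (\<lambda>u. fps_const a * fps_X * fps_exp (f u))"
  unfolding has_coeff_deriv_def
proof (intro allI)
  fix u :: real and k :: nat
  have "((\<lambda>u. f u ^ k / fact k) has_real_derivative real k * f u ^ (k - 1) * a / fact k) (at u)"
    by (rule derivative_eq_intros assms refl | simp)+
  moreover have "real k * f u ^ (k - 1) * a / fact k = (fps_const a * fps_X * fps_exp (f u)) $ k"
    by (cases k) (simp_all add: mult.assoc del: of_nat_Suc)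
  ultimately show "((\<lambda>u. fps_exp (f u) $ k) has_real_derivative
      (fps_const a * fps_X * fps_exp (f u)) $ k) (at u)"
    by simp
qed

lemma has_coeff_deriv_continuous: "has_coeff_deriv F F' \<Longrightarrow> coeff_continuous F"
  unfolding has_coeff_deriv_def coeff_continuous_def
  by (metis DERIV_isCont continuous_at_imp_continuous_on)

lemma coeff_continuous_const: "coeff_continuous (\<lambda>_. c)"
  by (simp add: coeff_continuous_def)

lemma coeff_continuous_mult:
  "coeff_continuous F \<Longrightarrow> coeff_continuous G \<Longrightarrow> coeff_continuous (\<lambda>u. F u * G u)"
  by (auto simp: coeff_continuous_def fps_mult_nth intro!: continuous_intros)

lemma coeff_continuous_diff:
  "coeff_continuous F \<Longrightarrow> coeff_continuous G \<Longrightarrow> coeff_continuous (\<lambda>u. F u - G u)"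
  by (auto simp: coeff_continuous_def intro!: continuous_intros)

lemma coeff_continuous_power: "coeff_continuous F \<Longrightarrow> coeff_continuous (\<lambda>u. F u ^ n)"
  by (induction n) (auto intro: coeff_continuous_const coeff_continuous_mult)

section \<open>Coefficientwise integration over the unit interval\<close>

lemma coeff_continuous_integrable:
  "coeff_continuous F \<Longrightarrow> (\<lambda>u. F u $ k) integrable_on {0..1}"
  by (auto simp: coeff_continuous_def intro!: integrable_continuous_interval
      intro: continuous_on_subset)

lemma coeff_integral_diff:
  assumes "coeff_continuous F" "coeff_continuous G"
  shows "coeff_integral (\<lambda>u. F u - G u) = coeff_integral F - coeff_integral G"
  using assms
  by (auto simp: fps_eq_iff coeff_integral_def intro!: integral_diff coeff_continuous_integrable)

text \<open>The factor \<open>c\<close> is itself a power series in t, constant only in u. Each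
  coefficient of the product is a finite Cauchy sum, so linearity of the integral suffices.\<close>

lemma coeff_integral_mult_const:
  assumes "coeff_continuous F"
  shows "coeff_integral (\<lambda>u. c * F u) = c * coeff_integral F"
proof (rule fps_ext)
  fix k
  have "integral {0..1} (\<lambda>u. \<Sum>i=0..k. c $ i * F u $ (k - i))
      = (\<Sum>i=0..k. integral {0..1} (\<lambda>u. c $ i * F u $ (k - i)))"
    by (intro integral_sum) (auto intro!: integrable_on_mult_right coeff_continuous_integrable assms)
  then show "coeff_integral (\<lambda>u. c * F u) $ k = (c * coeff_integral F) $ k"
    by (simp add: coeff_integral_def fps_mult_nth)
qed

lemma coeff_integral_deriv:
  assumes "has_coeff_deriv F F'"
  shows "coeff_integral F' = F 1 - F 0"
proof (rule fps_ext)
  fix k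
  have "((\<lambda>u. F' u $ k) has_integral F 1 $ k - F 0 $ k) {0..1}"
    using assms
    by (intro fundamental_theorem_of_calculus)
       (auto simp: has_coeff_deriv_def has_real_derivative_iff_has_vector_derivative
         intro: has_vector_derivative_at_within)
  then show "coeff_integral F' $ k = (F 1 - F 0) $ k"
    by (simp add: coeff_integral_def integral_unique)
qed

section \<open>The quotient of hyperbolic sines\<close>

text \<open>This is 2 sinh((1 - u) t / 2) as a series in t.\<close>

definition exp_diff :: "real \<Rightarrow> real fps" where
  "exp_diff u = fps_exp ((1 - u) / 2) - fps_exp ((u - 1) / 2)"

text \<open>Both power series are divided by \<open>t\<close> since the denominator needs a non-zero constant term.\<close>

definition sinh_ratio :: "real \<Rightarrow> real fps" where
  "sinh_ratio u = fps_shift 1 (exp_diff u) * inverse (fps_shift 1 (exp_diff 0))"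

text \<open>This is -(t / 2) cosh((1 - u) t / 2) / sinh(t / 2), the u-derivative of W(u).\<close>

definition sinh_ratio' :: "real \<Rightarrow> real fps" where
  "sinh_ratio' u = - fps_const (1 / 2) * (fps_exp ((1 - u) / 2) + fps_exp ((u - 1) / 2))
     * inverse (fps_shift 1 (exp_diff 0))"

lemma X_shift_exp_diff: "fps_X * fps_shift 1 (exp_diff u) = exp_diff u"
proof (rule fps_ext)
  fix k show "(fps_X * fps_shift 1 (exp_diff u)) $ k = exp_diff u $ k"
    by (cases k) (simp_all add: exp_diff_def)
qed

lemma shift_exp_diff_nonzero: "fps_shift 1 (exp_diff 0) $ 0 \<noteq> 0"
  by (simp add: exp_diff_def)

text \<open>Used to clear denominators: multiplication by \<open>exp_diff 0\<close> leaves
  expressions in exponentials only.\<close>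

lemma inverse_shift_exp_diff: "inverse (fps_shift 1 (exp_diff 0)) * exp_diff 0 = fps_X"
proof -
  have "inverse (fps_shift 1 (exp_diff 0)) * exp_diff 0
      = fps_X * (inverse (fps_shift 1 (exp_diff 0)) * fps_shift 1 (exp_diff 0))"
    by (metis X_shift_exp_diff mult.left_commute)
  then show ?thesis
    using inverse_mult_eq_1[OF shift_exp_diff_nonzero] by (simp only: mult_1_right)
qed

lemma sinh_ratio_mult: "sinh_ratio u * exp_diff 0 = exp_diff u"
  unfolding sinh_ratio_def
  by (metis X_shift_exp_diff inverse_shift_exp_diff mult.assoc mult.commute)

lemma sinh_ratio'_mult:
  "sinh_ratio' u * exp_diff 0
    = - fps_const (1 / 2) * fps_X * (fps_exp ((1 - u) / 2) + fps_exp ((u - 1) / 2))"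
  unfolding sinh_ratio'_def mult.assoc inverse_shift_exp_diff by (simp add: mult_ac)

lemma sinh_ratio_0: "sinh_ratio 0 = 1"
  unfolding sinh_ratio_def
  by (metis inverse_mult_eq_1 mult.commute shift_exp_diff_nonzero)

lemma sinh_ratio_1: "sinh_ratio 1 = 0"
  by (simp add: sinh_ratio_def exp_diff_def)

lemma has_coeff_deriv_exp_half:
  "has_coeff_deriv (\<lambda>u. fps_exp ((1 - u) / 2))
     (\<lambda>u. - fps_const (1 / 2) * fps_X * fps_exp ((1 - u) / 2))"
  "has_coeff_deriv (\<lambda>u. fps_exp ((u - 1) / 2))
     (\<lambda>u. fps_const (1 / 2) * fps_X * fps_exp ((u - 1) / 2))"
  unfolding fps_const_neg
  by (intro has_coeff_deriv_exp; (rule derivative_eq_intros refl | simp)+)+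

lemma has_coeff_deriv_sinh_ratio: "has_coeff_deriv sinh_ratio sinh_ratio'"
proof -
  let ?C = "\<lambda>u. - fps_const (1 / 2) * (fps_exp ((1 - u) / 2) + fps_exp ((u - 1) / 2) :: real fps)"
  have "has_coeff_deriv exp_diff (\<lambda>u. fps_X * ?C u)"
  proof -
    have "- fps_const (1 / 2) * fps_X * fps_exp ((1 - u) / 2)
        - fps_const (1 / 2) * fps_X * fps_exp ((u - 1) / 2) = fps_X * ?C u" for u
      by algebra
    then show ?thesis
      using has_coeff_deriv_diff[OF has_coeff_deriv_exp_half]
      unfolding exp_diff_def[abs_def] by simp
  qed
  then have "has_coeff_deriv (\<lambda>u. fps_shift 1 (exp_diff u)) ?C"
    using has_coeff_deriv_shift[of exp_diff "\<lambda>u. fps_X * ?C u" 1]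
    by (simp only: fps_shift_times_fps_X' mult.commute[of fps_X])
  from has_coeff_deriv_mult[OF this has_coeff_deriv_const] show ?thesis
    by (simp add: sinh_ratio_def[abs_def] sinh_ratio'_def[abs_def])
qed

text \<open>As a hyperbolic sine in u, W satisfies W'' = (t^2 / 4) W. The factor t^2 links each
  coefficient to the one two places before.\<close>

lemma has_coeff_deriv_sinh_ratio':
  "has_coeff_deriv sinh_ratio' (\<lambda>u. fps_const (1 / 4) * fps_X ^ 2 * sinh_ratio u)"
proof -
  let ?i = "inverse (fps_shift 1 (exp_diff 0))"
  let ?D = "\<lambda>u. - fps_const (1 / 2) * fps_X * fps_exp ((1 - u) / 2)
     + fps_const (1 / 2) * fps_X * (fps_exp ((u - 1) / 2) :: real fps)"
  have c: "fps_const (1 / 4 :: real) = fps_const (1 / 2) * fps_const (1 / 2)"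
    by simp
  have "- fps_const (1 / 2) * ?D u = fps_const (1 / 4) * fps_X ^ 2 * fps_shift 1 (exp_diff u)" for u
  proof -
    have "- fps_const (1 / 2) * ?D u
        = (fps_const (1 / 2) * fps_const (1 / 2)) * fps_X
          * (fps_exp ((1 - u) / 2) - fps_exp ((u - 1) / 2))"
      by algebra
    also have "\<dots> = (fps_const (1 / 2) * fps_const (1 / 2)) * fps_X * (fps_X * fps_shift 1 (exp_diff u))"
      unfolding X_shift_exp_diff by (simp add: exp_diff_def)
    finally show ?thesis
      unfolding c by (simp only: power2_eq_square mult.assoc)
  qed
  moreover have "has_coeff_deriv sinh_ratio' (\<lambda>u. - fps_const (1 / 2) * ?D u * ?i)"
    using has_coeff_deriv_mult[OF has_coeff_deriv_mult[OF has_coeff_deriv_const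
      has_coeff_deriv_add[OF has_coeff_deriv_exp_half]] has_coeff_deriv_const]
    by (simp add: sinh_ratio'_def[abs_def])
  ultimately show ?thesis
    by (simp add: sinh_ratio_def mult.assoc)
qed

section \<open>The generating function\<close>

definition G_gf :: "nat \<Rightarrow> real \<Rightarrow> real fps" where
  "G_gf r x = of_nat (r + 1) * fps_X * coeff_integral (\<lambda>u. fps_exp (x * u) * sinh_ratio u ^ r)"

lemma has_coeff_deriv_exp_mult:
  "has_coeff_deriv (\<lambda>u. fps_exp (x * u)) (\<lambda>u. fps_const x * fps_X * fps_exp (x * u))"
  by (intro has_coeff_deriv_exp; (rule derivative_eq_intros refl | simp)+)

lemma coeff_continuous_integrand: "coeff_continuous (\<lambda>u. fps_exp (x * u) * sinh_ratio u ^ r)"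
  by (intro coeff_continuous_mult coeff_continuous_power
      has_coeff_deriv_continuous[OF has_coeff_deriv_exp_mult]
      has_coeff_deriv_continuous[OF has_coeff_deriv_sinh_ratio])

text \<open>After clearing denominators this is the addition theorem for sinh(t / 2) with t / 2 = u
  t / 2 + (1 - u) t / 2.\<close>

lemma exp_sinh_ratio_identity:
  fixes u :: real
  defines "a \<equiv> fps_exp (u / 2)" and "b \<equiv> fps_exp (- u / 2)"
  shows "fps_const (1 / 2) * fps_X * ((a + b) * sinh_ratio u) = fps_X + (a - b) * sinh_ratio' u"
proof -
  define e f where "e = fps_exp ((1 - u) / 2)" and "f = fps_exp ((u - 1) / 2)"
  have ae: "a * e = fps_exp (1 / 2)" "b * f = fps_exp (- 1 / 2)"
    unfolding a_def b_def e_def f_def fps_exp_add_mult[symmetric] by (simp_all add: field_simps)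
  have D: "exp_diff 0 = a * e - b * f"
    unfolding ae by (simp add: exp_diff_def)
  have nz: "exp_diff 0 \<noteq> 0"
    by (simp add: exp_diff_def)
  have h: "fps_const (1 / 2) + fps_const (1 / 2) = (1 :: real fps)"
    by simp
  \<comment> \<open>With 1/2 abstracted to \<open>h\<close>, the claim is a polynomial identity
    modulo \<open>h + h = 1\<close>.\<close>
  have alg: "h * X * ((a + b) * (e - f)) = X * (a * e - b * f) + (a - b) * (- h * X * (e + f))"
    if "h + h = 1" for h X :: "real fps"
  proof -
    have "X * (a * e - b * f) = (h + h) * X * (a * e - b * f)"
      using that by simp
    then show ?thesis
      by (simp add: algebra_simps)
  qed
  have "fps_const (1 / 2) * fps_X * ((a + b) * (sinh_ratio u * exp_diff 0))
      = fps_X * exp_diff 0 + (a - b) * (sinh_ratio' u * exp_diff 0)"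
    unfolding sinh_ratio_mult sinh_ratio'_mult
    unfolding D exp_diff_def[of u] e_def[symmetric] f_def[symmetric]
    by (rule alg[OF h])
  then have "(fps_const (1 / 2) * fps_X * ((a + b) * sinh_ratio u)) * exp_diff 0
      = (fps_X + (a - b) * sinh_ratio' u) * exp_diff 0"
    by (simp only: ring_distribs mult.assoc)
  then show ?thesis
    using nz by simp
qed

text \<open>Integration by parts: the boundary terms of
  \<open>exp(y u t) (exp(u t/2) - exp(-u t/2)) W(u)^(r+1)\<close> vanish, at \<open>u = 0\<close> because of the middle
  factor and at \<open>u = 1\<close> because of the last one.\<close>

lemma G_gf_difference:
  fixes y :: real and r :: nat
  defines "c \<equiv> real (r + 2) / 2"
  shows "fps_const (y + c) * G_gf (Suc r) (y + 1 / 2) - fps_const (y - c) * G_gf (Suc r) (y - 1 / 2)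
    = of_nat (r + 2) * G_gf r y"
proof -
  define E where "E x = (\<lambda>u. fps_exp (x * u) :: real fps)" for x
  define J where "J = (\<lambda>s x u. E x u * sinh_ratio u ^ s)"
  define a b where "a u = (fps_exp (u / 2) :: real fps)" and "b u = (fps_exp (- u / 2) :: real fps)"
    for u :: real
  have E: "E (y + 1 / 2) u = E y u * a u" "E (y - 1 / 2) u = E y u * b u" for u
    unfolding E_def a_def b_def fps_exp_add_mult[symmetric] by (simp_all add: field_simps)
  define P where "P u = (E (y + 1 / 2) u - E (y - 1 / 2) u) * sinh_ratio u ^ Suc r" for u
  define P' where "P' u =
      (fps_const (y + 1 / 2) * fps_X * E (y + 1 / 2) u - fps_const (y - 1 / 2) * fps_X * E (y - 1 / 2) u)
        * sinh_ratio u ^ Suc r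
      + (E (y + 1 / 2) u - E (y - 1 / 2) u) * (of_nat (Suc r) * sinh_ratio u ^ r * sinh_ratio' u)" for u
  have "has_coeff_deriv P P'"
    unfolding P_def[abs_def] P'_def[abs_def] E_def
    by (intro has_coeff_deriv_mult has_coeff_deriv_diff has_coeff_deriv_exp_mult
        has_coeff_deriv_power has_coeff_deriv_sinh_ratio)
  from coeff_integral_deriv[OF this] have "coeff_integral P' = 0"
    by (simp add: P_def E_def sinh_ratio_1)
  moreover have P': "P' u = fps_const (y + c) * fps_X * J (Suc r) (y + 1 / 2) u
      - fps_const (y - c) * fps_X * J (Suc r) (y - 1 / 2) u - of_nat (Suc r) * fps_X * J r y u" for u
  proof -
    have y: "fps_const (y + 1 / 2) = fps_const y + fps_const (1 / 2)"
      "fps_const (y - 1 / 2) = fps_const y - fps_const (1 / 2)"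
      "fps_const (y + c) = fps_const y + fps_const (1 / 2) + of_nat (Suc r) * fps_const (1 / 2)"
      "fps_const (y - c) = fps_const y - fps_const (1 / 2) - of_nat (Suc r) * fps_const (1 / 2)"
      unfolding c_def fps_of_nat[symmetric] by (simp_all add: fps_eq_iff field_simps)
    \<comment> \<open>The addition identity, multiplied by \<open>N * e * w\<close>, trades the term
      with W' for terms with W. This adds \<open>N * h\<close> = (r + 1) / 2 to the 1/2 from the
      exponentials, which is why \<open>c\<close> is (r + 2) / 2.\<close>
    have alg: "((Y + h) * X * (e * a) - (Y - h) * X * (e * b)) * (S * w) + (e * a - e * b) * (N * w * S')
        = (Y + h + N * h) * X * (e * a * (S * w)) - (Y - h - N * h) * X * (e * b * (S * w))
          - N * X * (e * w)"
      if "h * X * ((a + b) * S) = X + (a - b) * S'" for h X a b S S' e w N Y :: "real fps"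
    proof -
      from that have "N * e * w * (h * X * ((a + b) * S)) = N * e * w * (X + (a - b) * S')"
        by simp
      then show ?thesis
        by (simp add: algebra_simps)
    qed
    show ?thesis
      unfolding P'_def J_def E y power_Suc
      by (rule alg[OF exp_sinh_ratio_identity[of u, folded b_def, folded a_def]])
  qed
  moreover have J: "coeff_continuous (J s x)" for s x
    unfolding J_def E_def by (rule coeff_continuous_integrand)
  have "coeff_integral P' = fps_const (y + c) * fps_X * coeff_integral (J (Suc r) (y + 1 / 2))
      - fps_const (y - c) * fps_X * coeff_integral (J (Suc r) (y - 1 / 2))
      - of_nat (Suc r) * fps_X * coeff_integral (J r y)"
    unfolding P' [abs_def]
    by (simp add: coeff_integral_diff coeff_integral_mult_const J
        coeff_continuous_mult coeff_continuous_const coeff_continuous_diff del: of_nat_Suc)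
  ultimately have z: "fps_const (y + c) * fps_X * coeff_integral (J (Suc r) (y + 1 / 2))
      - fps_const (y - c) * fps_X * coeff_integral (J (Suc r) (y - 1 / 2))
      = of_nat (Suc r) * fps_X * coeff_integral (J r y)"
    by simp
  have G: "G_gf s x = of_nat (s + 1) * fps_X * coeff_integral (J s x)" for s x
    by (simp add: G_gf_def J_def E_def)
  have "of_nat (r + 2) * (fps_const (y + c) * fps_X * coeff_integral (J (Suc r) (y + 1 / 2))
      - fps_const (y - c) * fps_X * coeff_integral (J (Suc r) (y - 1 / 2)))
      = of_nat (r + 2) * (of_nat (r + 1) * fps_X * coeff_integral (J r y))"
    unfolding z by simp
  moreover have "Suc r + 1 = r + 2"
    by simp
  ultimately show ?thesis
    unfolding G by (simp only: right_diff_distrib mult_ac)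
qed

text \<open>With W^0 = 1 the series is (exp(x t) - 1) / x for nonzero x, which encodes n^(p+1) = n
  n^p.\<close>

lemma G_gf_0: "G_gf 0 x $ Suc p = x ^ p / fact (Suc p)"
proof -
  have "((\<lambda>u. u ^ Suc p / Suc p) has_real_derivative u ^ p) (at u)" for u :: real
    by (rule derivative_eq_intros refl | simp del: of_nat_Suc)+
  then have "((\<lambda>u::real. u ^ p) has_integral 1 ^ Suc p / Suc p - 0 ^ Suc p / Suc p) {0..1}"
    by (intro fundamental_theorem_of_calculus)
       (auto simp: has_real_derivative_iff_has_vector_derivative intro: has_vector_derivative_at_within)
  then have "integral {0..1} (\<lambda>u::real. u ^ p) = 1 / Suc p"
    by (simp add: integral_unique)
  then show ?thesis
    by (simp add: G_gf_def coeff_integral_def power_mult_distrib)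
qed

text \<open>Outer induction on r, inner on n. The half-integral shift places two neighbouring
  arguments at order r + 1 symmetrically around the argument y at order r, as the difference
  equation requires.\<close>

lemma hyper_sum_eq_G_gf:
  "real (hyper_sum (Suc p) r n) =
    real ((n + r) choose (r + 1)) * (fact (Suc p) * G_gf r (N_shift r n) $ Suc p)"
proof (induction r arbitrary: n)
  case 0
  show ?case by (simp add: G_gf_0 N_shift_def del: fact_Suc)
next
  case (Suc r)
  note IH = this
  show ?case
  proof (induction n)
    case 0
    show ?case by (simp add: binomial_eq_0 del: binomial_Suc_Suc)
  next
    case (Suc n)
    define y where "y = real n + 1 + real r / 2"
    define c where "c = real (r + 2) / 2"
    define B where "B = real ((Suc n + r) choose (r + 1))"
    have N: "N_shift (Suc r) (Suc n) = y + 1 / 2" "N_shift (Suc r) n = y - 1 / 2"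
      "N_shift r (Suc n) = y"
      by (simp_all add: N_shift_def y_def field_simps)
    \<comment> \<open>The multipliers of the difference equation become the integers n + r + 2 and
      n, which are those of the absorption identities for binomial coefficients.\<close>
    have yc: "y + c = real (Suc n + Suc r)" "y - c = real n"
      by (simp_all add: y_def c_def field_simps)
    have B1: "real (r + 2) * real ((Suc n + Suc r) choose (Suc r + 1)) = (y + c) * B"
      unfolding yc B_def of_nat_mult[symmetric]
      using Suc_times_binomial_eq[of "Suc n + r" "r + 1"] by simp
    have "Suc (Suc r) * ((n + Suc r) choose Suc (Suc r)) = n * ((n + Suc r) choose Suc r)"
    proof (cases n)
      case (Suc k)
      then show ?thesis
        using Suc_times_binomial_add[of "Suc r" k] by (simp add: add.commute)
    qed simp
    then have B2: "real (r + 2) * real ((n + Suc r) choose (Suc r + 1)) = (y - c) * B"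
      unfolding yc B_def of_nat_mult[symmetric]
      by (simp add: mult.commute)
    define g1 g2 g0 where "g1 = G_gf (Suc r) (y + 1 / 2) $ Suc p"
      and "g2 = G_gf (Suc r) (y - 1 / 2) $ Suc p" and "g0 = G_gf r y $ Suc p"
    have "(y + c) * g1 - (y - c) * g2 = real (r + 2) * g0"
      using arg_cong[OF G_gf_difference[of y r, folded c_def], of "\<lambda>F. F $ Suc p"]
      unfolding g1_def g2_def g0_def fps_of_nat[symmetric] by (simp del: fps_of_nat)
    then have "B * fact (Suc p) * ((y + c) * g1) = B * fact (Suc p) * ((y - c) * g2 + real (r + 2) * g0)"
      by simp
    then have "(y + c) * B * (fact (Suc p) * g1)
        = (y - c) * B * (fact (Suc p) * g2) + real (r + 2) * (B * (fact (Suc p) * g0))"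
      by (simp only: distrib_left mult_ac)
    then have *: "real ((Suc n + Suc r) choose (Suc r + 1)) * (fact (Suc p) * g1)
        = real ((n + Suc r) choose (Suc r + 1)) * (fact (Suc p) * g2) + B * (fact (Suc p) * g0)"
      unfolding B1[symmetric] B2[symmetric] mult.assoc distrib_left[symmetric]
      by (simp only: mult_cancel_left) simp
    have "real (hyper_sum (Suc p) (Suc r) (Suc n))
        = real (hyper_sum (Suc p) (Suc r) n) + real (hyper_sum (Suc p) r (Suc n))"
      by simp
    also have "\<dots> = real ((n + Suc r) choose (Suc r + 1)) * (fact (Suc p) * g2)
        + B * (fact (Suc p) * g0)"
      unfolding Suc IH N g2_def g0_def B_def by simp
    finally show ?case
      unfolding N * [symmetric] g1_def by simp
  qed
qed

section \<open>Alternating signs\<close>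

text \<open>By the mean value theorem, a nonpositive value at u would force a slope at most 0 to its
  left and at least 0 to its right, although the slope strictly decreases.\<close>

lemma pos_if_deriv2_neg:
  fixes f f' f'' :: "real \<Rightarrow> real"
  assumes f: "\<And>u. (f has_real_derivative f' u) (at u)"
    and f': "\<And>u. (f' has_real_derivative f'' u) (at u)"
    and neg: "\<And>u. 0 < u \<Longrightarrow> u < 1 \<Longrightarrow> f'' u < 0"
    and 0: "f 0 \<ge> 0" "f 1 \<ge> 0" and u: "0 < u" "u < 1"
  shows "f u > 0"
proof (rule ccontr)
  assume le: "\<not> f u > 0"
  obtain s where s: "0 < s" "s < u" "f u - f 0 = (u - 0) * f' s"
    using MVT2[OF u(1) f] by blast
  obtain t where t: "u < t" "t < 1" "f 1 - f u = (1 - u) * f' t"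
    using MVT2[OF u(2) f] by blast
  have "f' s \<le> 0"
    using s(3)[unfolded diff_zero] le 0(1) mult_pos_pos[OF u(1), of "f' s"] by (intro leI notI) linarith
  moreover have "f' t \<ge> 0"
    using t(3) le 0(2) mult_pos_neg[of "1 - u" "f' t"] u(2) by (intro leI notI) linarith
  moreover obtain z where z: "s < z" "z < t" "f' t - f' s = (t - s) * f'' z"
    using MVT2[of s t f' f''] f' s t by force
  moreover have "(t - s) * f'' z < 0"
    using z s t neg[of z] by (intro mult_pos_neg) auto
  ultimately show False by linarith
qed

text \<open>Handles the coefficients of W whose second derivative vanishes: the constant one, 1 - u,
  and inductively all odd ones, which are zero.\<close>

lemma linear_if_deriv2_zero:
  fixes f f' :: "real \<Rightarrow> real"
  assumes f: "\<And>u. (f has_real_derivative f' u) (at u)"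
    and f': "\<And>u. (f' has_real_derivative 0) (at u)"
  shows "f u = f 0 + (f 1 - f 0) * u"
proof -
  obtain c where c: "f' u = c" for u
    using DERIV_isconst_all[of f'] f' by metis
  have "((\<lambda>u. f u - c * u) has_real_derivative 0) (at u)" for u
    by (rule derivative_eq_intros f refl | simp add: c)+
  then have "f u - c * u = f 0 - c * 0" "f 1 - c * 1 = f 0 - c * 0"
    using DERIV_isconst_all by blast+
  then show ?thesis by (simp add: algebra_simps)
qed

text \<open>Equivalently, replacing t by i t gives an even series with all even coefficients
  positive, which explains the closure under products.\<close>

definition alternating :: "real fps \<Rightarrow> bool" where
  "alternating F \<longleftrightarrow> (\<forall>k. if even k then (- 1) ^ (k div 2) * F $ k > 0 else F $ k = 0)"

lemma alternating_even: "alternating F \<Longrightarrow> (- 1) ^ k * F $ (2 * k) > 0"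
  unfolding alternating_def by (metis dvd_triv_left nonzero_mult_div_cancel_left zero_neq_numeral)

lemma alternating_odd: "alternating F \<Longrightarrow> odd k \<Longrightarrow> F $ k = 0"
  unfolding alternating_def by metis

lemma alternating_mult:
  assumes F: "alternating F" and G: "alternating G"
  shows "alternating (F * G)"
  unfolding alternating_def
proof (intro allI, split if_split, intro conjI impI)
  fix k :: nat assume "even k"
  then obtain n where n: "k = 2 * n" by blast
  have pos: "(- 1) ^ n * (F $ (2 * i) * G $ (2 * n - 2 * i)) > 0" if "i \<le> n" for i
  proof -
    have "(- 1) ^ n * (F $ (2 * i) * G $ (2 * n - 2 * i))
        = ((- 1) ^ i * F $ (2 * i)) * ((- 1) ^ (n - i) * G $ (2 * (n - i)))"
      using that power_add[of "- 1 :: real" i "n - i"]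
      by (simp only: le_add_diff_inverse diff_mult_distrib mult_ac)
    then show ?thesis
      by (simp only: mult_pos_pos[OF alternating_even[OF F] alternating_even[OF G]])
  qed
  have "(- 1) ^ n * (F $ i * G $ (k - i)) \<ge> 0" if "i \<le> k" for i
  proof (cases "even i")
    case True
    then obtain j where "i = 2 * j" by blast
    with pos[of j] that n show ?thesis by simp
  next
    case False
    then show ?thesis by (simp add: alternating_odd[OF F])
  qed
  \<comment> \<open>No term is negative, and the term with index 0 makes the sum strictly
    positive.\<close>
  then have "(\<Sum>i=0..k. (- 1) ^ n * (F $ i * G $ (k - i))) > 0"
    using pos[of 0] n by (intro sum_pos2[of _ 0]) auto
  then show "(- 1) ^ (k div 2) * (F * G) $ k > 0"
    by (simp add: n fps_mult_nth sum_distrib_left)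
next
  fix k :: nat assume "odd k"
  then have "F $ i * G $ (k - i) = 0" if "i \<le> k" for i
    using that alternating_odd[OF F, of i] alternating_odd[OF G, of "k - i"] by (cases "odd i") auto
  then show "(F * G) $ k = 0"
    unfolding fps_mult_nth by (intro sum.neutral) auto
qed

text \<open>The exponent is positive because the series 1 has vanishing higher even coefficients.
  Here \<open>r \<ge> 1\<close> enters the sign statements.\<close>

lemma alternating_power: "alternating F \<Longrightarrow> alternating (F ^ Suc n)"
  by (induction n) (auto intro: alternating_mult)

text \<open>The coefficients of \<^const>\<open>sinh_ratio\<close> vanish at \<open>u = 0\<close> and \<open>u = 1\<close> (apart from the initial
  one), and the second derivative of each is a quarter of the one two places before; hence
  positivity on the open unit interval propagates as concavity, with a sign change at each step.\<close>

lemma alternating_sinh_ratio: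
  assumes u: "0 < u" "u < 1"
  shows "alternating (sinh_ratio u)"
proof -
  define f f' where "f k v = sinh_ratio v $ k" and "f' k v = sinh_ratio' v $ k" for k v
  have f: "(f k has_real_derivative f' k v) (at v)" for k v
    using has_coeff_deriv_sinh_ratio by (simp add: has_coeff_deriv_def f_def[abs_def] f'_def)
  have f': "(f' k has_real_derivative (if k < 2 then 0 else f (k - 2) v / 4)) (at v)" for k v
    using has_coeff_deriv_sinh_ratio'[unfolded has_coeff_deriv_def, THEN spec, THEN spec, of k v]
    by (cases "k < 2") (simp_all add: f_def f'_def[abs_def] mult.assoc fps_X_power_mult_nth)
  have bd: "f k 0 = (if k = 0 then 1 else 0)" "f k 1 = 0" for k
    by (simp_all add: f_def sinh_ratio_0 sinh_ratio_1)
  have lin: "f k v = f k 0 + (f k 1 - f k 0) * v" if "k < 2 \<or> (\<forall>v. f (k - 2) v = 0)" for k v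
  proof (rule linear_if_deriv2_zero[OF f])
    show "(f' k has_real_derivative 0) (at v)" for v
      using f'[of k v] that by (auto split: if_splits)
  qed
  have odd: "f (2 * k + 1) v = 0" for k v
  proof (induction k arbitrary: v)
    case (Suc k)
    then show ?case using lin[of "2 * Suc k + 1" v] by (simp add: bd)
  qed (use lin[of 1] bd in simp)
  have even: "(- 1) ^ k * f (2 * k) v > 0" if "0 < v" "v < 1" for k v
    using that
  proof (induction k arbitrary: v)
    case 0
    then show ?case using lin[of 0 v] by (simp add: bd)
  next
    case (Suc k)
    have 1: "((\<lambda>v. (- 1) ^ Suc k * f (2 * Suc k) v) has_real_derivative
        (- 1) ^ Suc k * f' (2 * Suc k) v) (at v)" for v
      by (intro DERIV_cmult f)
    have 2: "((\<lambda>v. (- 1) ^ Suc k * f' (2 * Suc k) v) has_real_derivative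
        (- 1) ^ Suc k * (f (2 * k) v / 4)) (at v)" for v
      using f'[of "2 * Suc k" v] by (intro DERIV_cmult) simp
    show ?case
      by (rule pos_if_deriv2_neg[OF 1 2]) (use Suc in \<open>auto simp: bd\<close>)
  qed
  show ?thesis
    unfolding alternating_def
    using odd[of _ u] even[OF u] by (auto simp: f_def elim!: evenE oddE)
qed

section \<open>The coefficients\<close>

text \<open>Index shift: \<open>G_coeff r p\<close> and \<open>G_explicit r p\<close> below belong to the power sums of exponent \<open>Suc p\<close>.\<close>

definition G_coeff :: "nat \<Rightarrow> nat \<Rightarrow> nat \<Rightarrow> real" where
  "G_coeff r p j = fact (Suc p) * real (r + 1) / fact j
     * integral {0..1} (\<lambda>u. u ^ j * (sinh_ratio u ^ r) $ (p - j))"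

lemma continuous_sinh_ratio_power: "continuous_on A (\<lambda>u. (sinh_ratio u ^ r) $ k)"
  using coeff_continuous_power[OF has_coeff_deriv_continuous[OF has_coeff_deriv_sinh_ratio]]
  by (auto simp: coeff_continuous_def intro: continuous_on_subset)

text \<open>The Cauchy product with exp(x u t) sorts the coefficient by powers of x. The factor t in
  \<open>G_gf\<close> lowers the index from \<open>Suc p\<close> to \<open>p\<close>.\<close>

lemma G_gf_nth: "fact (Suc p) * G_gf r x $ Suc p = (\<Sum>j\<le>p. G_coeff r p j * x ^ j)"
proof -
  have "integral {0..1} (\<lambda>u. \<Sum>j=0..p. x ^ j / fact j * (u ^ j * (sinh_ratio u ^ r) $ (p - j)))
      = (\<Sum>j=0..p. integral {0..1} (\<lambda>u. x ^ j / fact j * (u ^ j * (sinh_ratio u ^ r) $ (p - j))))"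
    by (intro integral_sum)
       (auto intro!: integrable_continuous_interval continuous_intros continuous_sinh_ratio_power)
  then have "coeff_integral (\<lambda>u. fps_exp (x * u) * sinh_ratio u ^ r) $ p
      = (\<Sum>j\<le>p. x ^ j / fact j * integral {0..1} (\<lambda>u. u ^ j * (sinh_ratio u ^ r) $ (p - j)))"
    by (simp add: coeff_integral_def fps_mult_nth power_mult_distrib atMost_atLeast0 mult.assoc)
  moreover have "G_gf r x $ Suc p
      = real (r + 1) * coeff_integral (\<lambda>u. fps_exp (x * u) * sinh_ratio u ^ r) $ p"
    unfolding G_gf_def fps_of_nat[symmetric] mult.assoc by simp
  ultimately show ?thesis
    by (simp add: G_coeff_def sum_distrib_left mult_ac del: fact_Suc)
qed

lemma G_coeff_odd:
  assumes "r \<ge> 1" "odd (p - j)"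
  shows "G_coeff r p j = 0"
proof -
  obtain s where r: "r = Suc s" using assms by (cases r) auto
  have "((\<lambda>u. u ^ j * (sinh_ratio u ^ r) $ (p - j)) has_integral 0) {0..1}"
  \<comment> \<open>The alternating property is available only for 0 < u < 1; the two endpoints do
    not affect the integral.\<close>
  proof (rule has_integral_spike_finite[of "{0, 1}"])
    show "u ^ j * (sinh_ratio u ^ r) $ (p - j) = 0" if "u \<in> {0..1} - {0, 1}" for u
      using that assms(2) alternating_odd[OF alternating_power[OF alternating_sinh_ratio[of u]]]
      by (auto simp: r simp del: power_Suc)
  qed auto
  then show ?thesis
    by (simp add: G_coeff_def integral_unique)
qed

text \<open>Once multiplied by (-1)^k, the integrand is continuous and positive on the open
  interval, so its integral is strictly positive.\<close>

lemma G_coeff_even: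
  assumes "r \<ge> 1" "p = 2 * k + j"
  shows "(- 1) ^ k * G_coeff r p j > 0"
proof -
  obtain s where r: "r = Suc s" using assms by (cases r) auto
  have "integral {0..1} (\<lambda>u::real. 0)
      < integral {0..1} (\<lambda>u. (- 1) ^ k * (u ^ j * (sinh_ratio u ^ r) $ (p - j)))"
  proof (rule integral_less_real)
    fix u :: real assume "u \<in> {0<..<1}"
    then have "0 < u ^ j * ((- 1) ^ k * (sinh_ratio u ^ r) $ (2 * k))"
      using alternating_even[OF alternating_power[OF alternating_sinh_ratio[of u]], of k s]
      by (simp add: r del: power_Suc)
    then show "0 < (- 1) ^ k * (u ^ j * (sinh_ratio u ^ r) $ (p - j))"
      by (simp add: assms mult.left_commute)
  qed (auto intro!: continuous_intros continuous_sinh_ratio_power)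
  then have "0 < (- 1) ^ k * integral {0..1} (\<lambda>u. u ^ j * (sinh_ratio u ^ r) $ (p - j))"
    by simp
  then have "0 < fact (Suc p) * real (r + 1) / fact j
      * ((- 1) ^ k * integral {0..1} (\<lambda>u. u ^ j * (sinh_ratio u ^ r) $ (p - j)))"
    by (intro mult_pos_pos[OF divide_pos_pos]) simp_all
  then show ?thesis
    by (simp add: G_coeff_def mult_ac del: fact_Suc)
qed

text \<open>Induction on the degree: write q = q(a) + (x - a) s with a in \<open>A\<close>. The
  quotient s has smaller degree and rational values on the still infinite set
  \<open>A - {a}\<close>.\<close>

lemma coeff_rational_if_values_rational:
  fixes q :: "real poly"
  assumes "infinite A" "A \<subseteq> \<rat>" "\<And>x. x \<in> A \<Longrightarrow> poly q x \<in> \<rat>"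
  shows "coeff q i \<in> \<rat>"
  using assms
proof (induction "degree q" arbitrary: q A i rule: less_induct)
  case less
  obtain a where a: "a \<in> A"
    using less.prems(1) by (metis ex_in_conv finite.emptyI)
  define s where "s = synthetic_div q a"
  have q: "q = [:poly q a:] + pCons 0 s - smult a s"
    using synthetic_div_correct[of q a] unfolding s_def[symmetric]
    by (simp add: eq_diff_eq)
  have aQ: "a \<in> \<rat>" "poly q a \<in> \<rat>" using less.prems a by auto
  show ?case
  proof (cases "degree q = 0")
    case True
    then obtain c where "q = [:c:]" by (metis degree_eq_zeroE)
    then show ?thesis using aQ by (cases i) auto
  next
    case False
    have "poly s x \<in> \<rat>" if "x \<in> A - {a}" for x
    proof -
      have "poly q x = poly q a + (x - a) * poly s x"
        by (subst q) (simp add: algebra_simps)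
      then have "poly s x = (poly q x - poly q a) / (x - a)"
        using that by simp
      then show ?thesis
        using that less.prems aQ by auto
    qed
    moreover have "degree s < degree q"
      using False by (simp add: s_def degree_synthetic_div)
    ultimately have s: "coeff s i \<in> \<rat>" for i
      using less.prems(1,2) by (intro less.hyps[of s "A - {a}"]) auto
    show ?thesis
      by (subst q) (cases i; use s aQ in auto)
  qed
qed

section \<open>Existence, uniqueness and expansion of the polynomials\<close>

definition G_explicit :: "nat \<Rightarrow> nat \<Rightarrow> real poly" where
  "G_explicit r p = (\<Sum>j\<le>p. monom (G_coeff r p j) j)"

lemma coeff_G_explicit: "coeff (G_explicit r p) j = (if j \<le> p then G_coeff r p j else 0)"
  by (simp add: G_explicit_def coeff_sum)

text \<open>The recursion of the hyper-sums reduces to Pascal's rule. The closed form shows that the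
  divisor in \<open>is_G_poly\<close> is nonzero for n \<ge> 1.\<close>

lemma hyper_sum_1: "hyper_sum 1 r n = (n + r) choose (r + 1)"
proof (induction r arbitrary: n)
  case (Suc r)
  note IH = this
  show ?case
  proof (induction n)
    case (Suc n)
    have "hyper_sum 1 (Suc r) (Suc n) = hyper_sum 1 (Suc r) n + hyper_sum 1 r (Suc n)"
      by simp
    then show ?case
      unfolding Suc IH by simp
  qed (simp add: binomial_eq_0 del: binomial_Suc_Suc)
qed simp

lemma is_G_poly_G_explicit: "is_G_poly r (Suc p) (G_explicit r p)"
  unfolding is_G_poly_def hyper_sum_1 hyper_sum_eq_G_gf
  by (simp add: G_gf_nth G_explicit_def poly_sum poly_monom del: fact_Suc)

lemma infinite_range_N_shift: "infinite (N_shift r ` {1..})"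
  by (subst finite_image_iff) (auto simp: inj_on_def N_shift_def infinite_Ici)

text \<open>Cancelling the nonzero factor makes the difference vanish at infinitely many
  points.\<close>

lemma is_G_poly_unique:
  assumes "is_G_poly r p G" "is_G_poly r p H"
  shows "G = H"
proof (rule ccontr)
  assume "G \<noteq> H"
  then have "finite {x. poly (G - H) x = 0}"
    by (intro poly_roots_finite) simp
  moreover have "poly (G - H) (N_shift r n) = 0" if "n \<in> {1..}" for n
  proof -
    from that have "real (hyper_sum 1 r n) * poly G (N_shift r n)
        = real (hyper_sum 1 r n) * poly H (N_shift r n)" "hyper_sum 1 r n \<noteq> 0"
      using assms unfolding is_G_poly_def hyper_sum_1 by auto
    then show ?thesis
      by simp
  qed
  then have "N_shift r ` {1..} \<subseteq> {x. poly (G - H) x = 0}"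
    by blast
  ultimately show False
    using infinite_range_N_shift finite_subset by blast
qed

lemma G_poly_eq: "G_poly r (Suc p) = G_explicit r p"
  unfolding G_poly_def using is_G_poly_G_explicit is_G_poly_unique by blast

lemma is_G_poly_coeff_rational:
  assumes "is_G_poly r p G"
  shows "coeff G i \<in> \<rat>"
proof (rule coeff_rational_if_values_rational[OF infinite_range_N_shift])
  show "N_shift r ` {1..} \<subseteq> \<rat>"
    by (auto simp: N_shift_def)
  fix x assume "x \<in> N_shift r ` {1..}"
  then obtain n where n: "n \<ge> 1" "x = N_shift r n" by auto
  then have "hyper_sum 1 r n \<noteq> 0"
    unfolding hyper_sum_1 by auto
  then have "poly G x = real (hyper_sum p r n) / real (hyper_sum 1 r n)"
    using assms n by (auto simp: is_G_poly_def field_simps)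
  then show "poly G x \<in> \<rat>"
    by simp
qed

text \<open>The parameter \<open>d\<close> is the parity of the surviving powers, so one proof
  covers both families: \<open>d = 0\<close> for odd exponents of the power sum and
  \<open>d = 1\<close> for even ones.\<close>

lemma G_poly_expansion:
  fixes r M d :: nat
  assumes r: "r \<ge> 1" and d: "d \<le> 1"
  shows "\<exists>g :: nat \<Rightarrow> rat.
      (\<forall>x. poly (G_poly r (Suc (2 * M + d))) x = (\<Sum>j=0..M. of_rat (g j) * x ^ (2 * j + d)))
      \<and> (\<forall>j\<le>M. (- 1) ^ (M - j) * g j > 0)"
proof -
  define p where "p = 2 * M + d"
  define G where "G = G_explicit r p"
  have "\<forall>i. \<exists>q. coeff G i = real_of_rat q"
    using is_G_poly_coeff_rational[OF is_G_poly_G_explicit] unfolding G_def Rats_def by blast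
  then obtain q where q: "coeff G i = real_of_rat (q i)" for i by metis
  define g where "g j = q (2 * j + d)" for j
  have g: "real_of_rat (g j) = G_coeff r p (2 * j + d)" if "j \<le> M" for j
    using that q[of "2 * j + d"] unfolding g_def G_def coeff_G_explicit by (simp add: p_def)
  have "poly G x = (\<Sum>j=0..M. of_rat (g j) * x ^ (2 * j + d))" for x
  proof -
    have "poly G x = (\<Sum>i\<le>p. G_coeff r p i * x ^ i)"
      by (simp add: G_def G_explicit_def poly_sum poly_monom)
    also have "\<dots> = (\<Sum>i\<in>(\<lambda>j. 2 * j + d) ` {0..M}. G_coeff r p i * x ^ i)"
    proof (rule sum.mono_neutral_right)
      show "\<forall>i\<in>{..p} - (\<lambda>j. 2 * j + d) ` {0..M}. G_coeff r p i * x ^ i = 0"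
      proof
        fix i assume i: "i \<in> {..p} - (\<lambda>j. 2 * j + d) ` {0..M}"
        have "odd (p - i)"
        proof
          assume "even (p - i)"
          then obtain k where "p - i = 2 * k" by blast
          \<comment> \<open>From 2k \<le> 2M + d and d \<le> 1 follows k \<le> M, so the truncated
            subtraction is exact.\<close>
          with i d have "i = 2 * (M - k) + d" "M - k \<in> {0..M}"
            by (auto simp: p_def)
          with i show False by blast
        qed
        then show "G_coeff r p i * x ^ i = 0"
          using G_coeff_odd[OF r] by simp
      qed
    qed (auto simp: p_def)
    also have "\<dots> = (\<Sum>j=0..M. of_rat (g j) * x ^ (2 * j + d))"
      by (subst sum.reindex) (auto simp: inj_on_def g intro!: sum.cong)
    finally show ?thesis .
  qed
  moreover have "(- 1) ^ (M - j) * g j > 0" if "j \<le> M" for j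
  proof -
    have "(- 1) ^ (M - j) * real_of_rat (g j) > 0"
      unfolding g[OF that] using that by (intro G_coeff_even[OF r]) (simp add: p_def)
    then have "real_of_rat ((- 1) ^ (M - j) * g j) > 0"
      by (simp add: of_rat_mult of_rat_power)
    then show ?thesis
      by (simp only: zero_less_of_rat_iff)
  qed
  ultimately show ?thesis
    unfolding G_poly_eq p_def[symmetric] G_def[symmetric] by blast
qed

text \<open>The exponents of -1 at j and j + 1 differ by one, so the product of the two inequalities
  leaves a single factor -1.\<close>

lemma alternating_sign_consecutive:
  fixes g :: "nat \<Rightarrow> 'a::linordered_idom"
  assumes g: "\<forall>j\<le>M. (- 1) ^ (M - j) * g j > 0"
  shows "(\<forall>j\<le>M. g j \<noteq> 0) \<and> g M > 0 \<and> (\<forall>j<M. g (Suc j) * g j < 0)"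
proof (intro conjI allI impI)
  show "g j \<noteq> 0" if "j \<le> M" for j
    using g that by (metis less_irrefl mult_zero_right)
  show "g M > 0"
    using g[rule_format, of M] by simp
  fix j assume j: "j < M"
  then have M: "M - j = Suc (M - Suc j)" by simp
  have "0 < ((- 1) ^ (M - Suc j) * g (Suc j)) * ((- 1) ^ (M - j) * g j)"
    using g j by (intro mult_pos_pos[OF g[rule_format] g[rule_format]]) auto
  also have "\<dots> = - (g (Suc j) * g j)"
    unfolding M by (simp add: mult.left_commute flip: mult.assoc power_add power_mult_distrib)
  finally show "g (Suc j) * g j < 0" by simp
qed

theorem theorem5:
  fixes r m :: nat
  assumes "r \<ge> 1" and "m \<ge> 1"
  shows "(\<forall>p\<ge>1. \<exists>!G. is_G_poly r p G) \<and>
    (\<exists>g :: nat \<Rightarrow> rat.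
      (\<forall>n\<ge>1. poly (G_poly r (2 * m - 1)) (N_shift r n)
              = (\<Sum>j = 0..m - 1. of_rat (g j) * N_shift r n ^ (2 * j))) \<and>
      (\<forall>j\<le>m - 1. g j \<noteq> 0) \<and>
      g (m - 1) > 0 \<and>
      (\<forall>j<m - 1. g (Suc j) * g j < 0)) \<and>
    (\<exists>g :: nat \<Rightarrow> rat.
      (\<forall>n\<ge>1. poly (G_poly r (2 * m)) (N_shift r n)
              = (\<Sum>j = 0..m - 1. of_rat (g j) * N_shift r n ^ (2 * j + 1))) \<and>
      (\<forall>j\<le>m - 1. g j \<noteq> 0) \<and>
      g (m - 1) > 0 \<and>
      (\<forall>j<m - 1. g (Suc j) * g j < 0))"
proof (intro conjI)
  show "\<forall>p\<ge>1. \<exists>!G. is_G_poly r p G"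
    using is_G_poly_G_explicit is_G_poly_unique by (metis Suc_le_D One_nat_def)
  \<comment> \<open>Both exponents take the form \<open>Suc (2 * M + d)\<close> with M = m - 1,
    where m \<ge> 1 keeps the subtraction exact.\<close>
  have eqs: "Suc (2 * (m - 1) + 0) = 2 * m - 1" "Suc (2 * (m - 1) + 1) = 2 * m"
    using assms(2) by auto
  show "\<exists>g :: nat \<Rightarrow> rat.
      (\<forall>n\<ge>1. poly (G_poly r (2 * m - 1)) (N_shift r n)
              = (\<Sum>j = 0..m - 1. of_rat (g j) * N_shift r n ^ (2 * j))) \<and>
      (\<forall>j\<le>m - 1. g j \<noteq> 0) \<and> g (m - 1) > 0 \<and> (\<forall>j<m - 1. g (Suc j) * g j < 0)"
    using G_poly_expansion[OF assms(1), of 0 "m - 1", unfolded eqs]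
      alternating_sign_consecutive[where 'a = rat, of "m - 1"] by auto
  show "\<exists>g :: nat \<Rightarrow> rat.
      (\<forall>n\<ge>1. poly (G_poly r (2 * m)) (N_shift r n)
              = (\<Sum>j = 0..m - 1. of_rat (g j) * N_shift r n ^ (2 * j + 1))) \<and>
      (\<forall>j\<le>m - 1. g j \<noteq> 0) \<and> g (m - 1) > 0 \<and> (\<forall>j<m - 1. g (Suc j) * g j < 0)"
    using G_poly_expansion[OF assms(1), of 1 "m - 1", unfolded eqs]
      alternating_sign_consecutive[where 'a = rat, of "m - 1"] by auto
qed

end
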